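(* Let $n\ge 2$ and let $W\subset \mathbb{N}^{n}$ be a finite nonempty $\mathfrak{S}_n$-invariant set of words of positive integers. Then (a) $\mathbb{E}_{W}[\mathrm{inv}]=\binom{n}{2}\mathbb{P}_{W}(\chi^{\mathrm{inv}}_1=1)$, (b) $\mathbb{E}_{W}[\mathrm{des}]=(n-1)\mathbb{P}_{W}(\chi^{\mathrm{inv}}_1=1)$, and (c) $\mathbb{E}_{W}[\mathrm{inv}]=\frac{n}{2}\mathbb{E}_{W}[\mathrm{des}]$.
   Context: $\mathbb{N}=\{1,2,\dots\}$. $W$ is $\mathfrak{S}_n$-invariant if $(w_{\sigma^{-1}(1)},\dots,w_{\sigma^{-1}(n)})\in W$ for all $w\in W$, $\sigma\in\mathfrak{S}_n$. $\mathrm{inv}(w)$ is the number of pairs $1\le i<j\le n$ with $w_i>w_j$; $\mathrm{des}(w)$ is the number of $i\in[n-1]$ with $w_i>w_{i+1}$; $\chi_1^{\mathrm{inv}}(w)=1$ if $w_1>w_2$ and $0$ otherwise. $\mathbb{E}_W$ and $\mathbb{P}_W$ denote expectation and probability for the uniform distribution on the finite set $W$. *)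

theory Defs
  imports "HOL-Probability.Probability_Mass_Function" "HOL-Combinatorics.Permutations"
begin

(* A word w_1 ... w_n is a list of length n; the letter w_i is w ! (i - 1), so that
   positions, and the symmetric group acting on them, are indexed by {..<n}. *)

definition words :: "nat \<Rightarrow> nat list set" where
  "words n = {w. length w = n \<and> (\<forall>a \<in> set w. a \<ge> 1)}"

(* For w of length n, permute_list (inv \<sigma>) w is the word whose i-th letter is
   the letter of w at position \<sigma>^{-1}(i). *)
definition sym_invariant :: "nat \<Rightarrow> nat list set \<Rightarrow> bool" where
  "sym_invariant n W \<longleftrightarrow>
     (\<forall>w \<in> W. \<forall>\<sigma>. \<sigma> permutes {..<n} \<longrightarrow> permute_list (inv \<sigma>) w \<in> W)"

definition word_inv :: "nat list \<Rightarrow> nat" where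
  "word_inv w = card {(i, j). i < j \<and> j < length w \<and> w ! i > w ! j}"

definition word_des :: "nat list \<Rightarrow> nat" where
  "word_des w = card {i. Suc i < length w \<and> w ! i > w ! Suc i}"

definition chi1_inv :: "nat list \<Rightarrow> nat" where
  "chi1_inv w = (if w ! 0 > w ! 1 then 1 else 0)"

definition expect_on :: "'a set \<Rightarrow> ('a \<Rightarrow> real) \<Rightarrow> real" where
  "expect_on W f = measure_pmf.expectation (pmf_of_set W) f"

definition prob_on :: "'a set \<Rightarrow> ('a \<Rightarrow> bool) \<Rightarrow> real" where
  "prob_on W P = measure_pmf.prob (pmf_of_set W) {w. P w}"

end

theory Submission
  imports Defs
begin

text \<open>
  The symmetric group acts doubly transitively on positions, so, \<open>W\<close> being invariant, permuting
  letters shows that the event \<open>w\<^sub>i > w\<^sub>j\<close> has the same probability for every ordered pair of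
  distinct positions, namely that of \<open>w\<^sub>1 > w\<^sub>2\<close> (\<open>card_inversion_at_eq\<close>). By linearity of
  expectation, any statistic counting the pairs \<open>(i, j)\<close> with \<open>w\<^sub>i > w\<^sub>j\<close> in a fixed set \<open>P\<close> of
  pairs of distinct positions therefore has expectation \<open>card P\<close> times this probability
  (\<open>expect_on_card_inversions\<close>). Inversions correspond to the \<open>n choose 2\<close> increasing pairs of
  positions and descents to the \<open>n - 1\<close> pairs of neighbouring positions; comparing the two
  multiples gives the ratio \<open>n / 2\<close>.
\<close>

lemma expect_on_eq_sum:
  assumes "finite W" "W \<noteq> {}"
  shows "expect_on W f = sum f W / card W"
  using assms by (simp add: expect_on_def integral_pmf_of_set)

lemma prob_on_eq_card:
  assumes "finite W" "W \<noteq> {}"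
  shows "prob_on W P = card {w \<in> W. P w} / card W"
  using assms by (simp add: prob_on_def measure_pmf_of_set Int_def)

lemma permutes_doubly_transitive:
  fixes i j :: nat
  assumes "i < n" "j < n" "i \<noteq> j"
  obtains p where "p permutes {..<n}" "p 0 = i" "p 1 = j"
proof
  \<comment> \<open>The inner transposition prepares position \<open>1\<close> for the outer one, which moves \<open>0\<close> to \<open>i\<close>.\<close>
  let ?p = "Transposition.transpose 0 i \<circ> Transposition.transpose 1 (Transposition.transpose 0 i j)"
  have "n \<ge> 2" using assms by linarith
  then show "?p permutes {..<n}"
    using assms by (intro permutes_compose permutes_swap_id) (auto simp: Transposition.transpose_def)
  show "?p 0 = i" "?p 1 = j"
    using assms by (auto simp: Transposition.transpose_def)
qed

text \<open>
  Relabelling the positions by a permutation \<open>p\<close> with \<open>p 0 = i\<close> and \<open>p 1 = j\<close> is a bijection of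
  \<open>W\<close> onto itself that carries the relation between letters \<open>i\<close> and \<open>j\<close> to letters \<open>0\<close> and \<open>1\<close>.
\<close>

lemma card_inversion_at_eq:
  assumes len: "\<And>w. w \<in> W \<Longrightarrow> length w = n" and sym: "sym_invariant n W"
    and ij: "i < n" "j < n" "i \<noteq> j"
  shows "card {w \<in> W. w ! i > w ! j} = card {w \<in> W. w ! 0 > w ! 1}"
proof -
  obtain p where p: "p permutes {..<n}" and p01: "p 0 = i" "p 1 = j"
    using permutes_doubly_transitive[OF ij] .
  have p': "inv p permutes {..<n}"
    using p by (rule permutes_inv)
  have n: "0 < n" "1 < n"
    using ij by auto
  have mem: "permute_list q w \<in> W" if "q permutes {..<n}" "w \<in> W" for q w
    using sym that permutes_inv[OF that(1)] permutes_inv_inv[OF that(1)]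
    unfolding sym_invariant_def by metis
  have cancel: "permute_list (inv p) (permute_list p w) = w"
      "permute_list p (permute_list (inv p) w) = w" if "w \<in> W" for w
    using that p p' len permutes_inv_o[OF p] by (simp_all flip: permute_list_compose)
  have nth: "permute_list p w ! 0 = w ! i" "permute_list p w ! 1 = w ! j" if "w \<in> W" for w
    using permute_list_nth[of p w 0] permute_list_nth[of p w 1] p p01 n len[OF that] by auto
  have "bij_betw (permute_list p) {w \<in> W. w ! i > w ! j} {w \<in> W. w ! 0 > w ! 1}"
  proof (rule bij_betw_byWitness[where f' = "permute_list (inv p)"])
    show "permute_list p ` {w \<in> W. w ! i > w ! j} \<subseteq> {w \<in> W. w ! 0 > w ! 1}"
      using mem[OF p] nth by auto
    show "permute_list (inv p) ` {w \<in> W. w ! 0 > w ! 1} \<subseteq> {w \<in> W. w ! i > w ! j}"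
      using mem[OF p'] nth[OF mem[OF p']] cancel by auto
  qed (use cancel in auto)
  then show ?thesis
    by (rule bij_betw_same_card)
qed

text \<open>Linearity of expectation, in the form of double counting pairs and words.\<close>

lemma expect_on_card_inversions:
  assumes W: "finite W" "W \<noteq> {}" and len: "\<And>w. w \<in> W \<Longrightarrow> length w = n"
    and sym: "sym_invariant n W"
    and P: "\<And>i j. (i, j) \<in> P \<Longrightarrow> i < n \<and> j < n \<and> i \<noteq> j"
  shows "expect_on W (\<lambda>w. real (card {(i, j) \<in> P. w ! i > w ! j}))
    = real (card P) * prob_on W (\<lambda>w. chi1_inv w = 1)"
proof -
  have "finite P"
    using P by (intro finite_subset[of P "{..<n} \<times> {..<n}"]) auto
  then have "(\<Sum>w\<in>W. card {x \<in> P. w ! fst x > w ! snd x})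
      = card {w \<in> W. w ! 0 > w ! 1} * card P"
    using W P len sym by (intro sum_multicount ballI card_inversion_at_eq) auto
  moreover have "{(i, j) \<in> P. w ! i > w ! j} = {x \<in> P. w ! fst x > w ! snd x}"
    for w :: "nat list"
    by auto
  ultimately have "(\<Sum>w\<in>W. real (card {(i, j) \<in> P. w ! i > w ! j}))
      = real (card P) * card {w \<in> W. w ! 0 > w ! 1}"
    by (simp only: mult.commute flip: of_nat_sum of_nat_mult)
  moreover have "chi1_inv w = 1 \<longleftrightarrow> w ! 0 > w ! 1" for w
    by (simp add: chi1_inv_def)
  ultimately show ?thesis
    by (simp only: expect_on_eq_sum[OF W] prob_on_eq_card[OF W] times_divide_eq_right)
qed

lemma card_increasing_pairs: "card {(i, j). i < j \<and> j < n} = n choose 2" for n :: nat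
proof (induction n)
  case (Suc n)
  have "{(i, j). i < j \<and> j < Suc n} = {(i, j). i < j \<and> j < n} \<union> {..<n} \<times> {n}"
    by auto
  moreover have "finite {(i, j). i < j \<and> j < n}"
    by (rule finite_subset[of _ "{..<n} \<times> {..<n}"]) auto
  ultimately have "card {(i, j). i < j \<and> j < Suc n}
      = card {(i, j). i < j \<and> j < n} + card ({..<n} \<times> {n})"
    by (simp only:) (rule card_Un_disjoint, auto)
  with Suc show ?case
    by (simp add: numeral_2_eq_2)
qed simp

theorem corollary5p3:
  fixes n :: nat and W :: "nat list set"
  assumes "n \<ge> 2"
    and "W \<subseteq> words n"
    and "finite W" and "W \<noteq> {}"
    and "sym_invariant n W"
  shows "expect_on W (\<lambda>w. real (word_inv w)) = real (n choose 2) * prob_on W (\<lambda>w. chi1_inv w = 1)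
    \<and> expect_on W (\<lambda>w. real (word_des w)) = (real n - 1) * prob_on W (\<lambda>w. chi1_inv w = 1)
    \<and> expect_on W (\<lambda>w. real (word_inv w)) = real n / 2 * expect_on W (\<lambda>w. real (word_des w))"
proof -
  let ?I = "{(i, j). i < j \<and> j < n}"
  let ?D = "(\<lambda>i. (i, Suc i)) ` {..<n - 1}"
  let ?prob = "prob_on W (\<lambda>w. chi1_inv w = 1)"
  have len: "length w = n" if "w \<in> W" for w
    using that assms(2) by (auto simp: words_def)
  have inv: "word_inv w = card {(i, j) \<in> ?I. w ! i > w ! j}" if "w \<in> W" for w
    using len[OF that] unfolding word_inv_def by (intro arg_cong[where f = card]) auto
  have des: "word_des w = card {(i, j) \<in> ?D. w ! i > w ! j}" if "w \<in> W" for w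
  proof -
    have "{(i, j) \<in> ?D. w ! i > w ! j}
        = (\<lambda>i. (i, Suc i)) ` {i. Suc i < length w \<and> w ! i > w ! Suc i}"
      using len[OF that] by auto
    then show ?thesis
      by (simp add: word_des_def card_image inj_on_def)
  qed
  have "expect_on W (\<lambda>w. real (word_inv w)) = expect_on W (\<lambda>w. real (card {(i, j) \<in> ?I. w ! i > w ! j}))"
    using assms(3,4) inv by (simp add: expect_on_eq_sum)
  also have "\<dots> = real (card ?I) * ?prob"
    using assms len by (intro expect_on_card_inversions) auto
  also have "card ?I = n choose 2"
    by (rule card_increasing_pairs)
  finally have a: "expect_on W (\<lambda>w. real (word_inv w)) = real (n choose 2) * ?prob" .
  have "expect_on W (\<lambda>w. real (word_des w)) = expect_on W (\<lambda>w. real (card {(i, j) \<in> ?D. w ! i > w ! j}))"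
    using assms(3,4) des by (simp add: expect_on_eq_sum)
  also have "\<dots> = real (card ?D) * ?prob"
    using assms len by (intro expect_on_card_inversions) auto
  also have "real (card ?D) = real n - 1"
    using assms(1) by (simp add: card_image inj_on_def of_nat_diff)
  finally have b: "expect_on W (\<lambda>w. real (word_des w)) = (real n - 1) * ?prob" .
  have "real (n choose 2) = real n / 2 * (real n - 1)"
    using assms(1) by (simp add: choose_two real_of_nat_div of_nat_diff)
  then have "real (n choose 2) * ?prob = real n / 2 * ((real n - 1) * ?prob)"
    by simp
  with a b show ?thesis
    by metis
qed

end
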